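(* For all integers $n, r \ge 0$ with $n \ge r$, $${n \brace \underbrace{1,1,\cdots,1}_{r\text{ times}}} = {n \brace r},$$ where the left-hand side is the multi-Stirling number of the second kind with index $(1,1,\dots,1)$ ($r$ ones) and the right-hand side is the ordinary Stirling number of the second kind.
   Context: For integers $k_1,\dots,k_r$ the multiple logarithm of index $(k_1,\dots,k_r)$ is the power series $$\mathrm{Li}_{k_1,k_2,\cdots,k_r}(t)=\sum_{0<m_1<m_2<\cdots<m_r}\frac{t^{m_r}}{m_1^{k_1}m_2^{k_2}\cdots m_r^{k_r}},$$ the sum being over integers $m_1,\dots,m_r$. For $r=0$ (empty index) the convention is $\mathrm{Li}_{\emptyset}(t)=1$. The multi-Stirling numbers of the second kind ${n \brace k_1,k_2,\cdots,k_r}$ are defined by the generating function (as a power series in $t$) $$\mathrm{Li}_{k_1,k_2,\cdots,k_r}(1-e^{1-e^t})=\sum_{n=r}^\infty {n \brace k_1,k_2,\cdots,k_r}\frac{t^n}{n!}.$$ The Stirling numbers of the second kind ${n \brace k}$ are defined by $x^n=\sum_{k=0}^n {n \brace k}(x)_k$ for $n\ge 0$, where $(x)_0=1$ and $(x)_n=x(x-1)\cdots(x-n+1)$ for $n\ge1$; equivalently $\frac{1}{k!}(e^t-1)^k=\sum_{n=k}^\infty {n \brace k}\frac{t^n}{n!}$ for $k\ge 0$. To avoid ambiguity when $r=1$: the symbol on the left-hand side of the claim is the multi-Stirling number with index $(1)$, defined through $\mathrm{Li}_1$, while the symbol on the right is the ordinary Stirling number. *)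

theory Defs
  imports
    "HOL-Computational_Algebra.Formal_Power_Series"
    "HOL-Combinatorics.Stirling"
begin

text \<open>
  The list \<open>[m\<^sub>1, \<dots>, m\<^sub>r]\<close> of a chain \<open>0 < m\<^sub>1 < \<dots> < m\<^sub>r = n\<close>. Prepending
  \<open>m\<^sub>0 = 0\<close> expresses positivity, and for \<open>r = 0\<close> it makes the empty chain the
  only chain, ending at \<open>n = 0\<close>, which gives the convention that the multiple
  logarithm of the empty index is 1.
\<close>

definition chains :: "nat \<Rightarrow> nat \<Rightarrow> nat list set" where
  "chains r n = {ms. length ms = r \<and> sorted_wrt (<) (0 # ms) \<and> last (0 # ms) = n}"

definition multi_log :: "int list \<Rightarrow> rat fps" where
  "multi_log ks =
     Abs_fps (\<lambda>n. \<Sum>ms\<in>chains (length ks) n.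
       1 / (\<Prod>i<length ks. of_nat (ms ! i) powi (ks ! i)))"

definition multi_Stirling :: "nat \<Rightarrow> int list \<Rightarrow> rat" where
  "multi_Stirling n ks =
     fact n * fps_nth (multi_log ks oo (1 - (fps_exp 1 oo (1 - fps_exp 1)))) n"

text \<open>The sums in \<open>multi_log\<close> are over finite sets.\<close>

lemma chains_bounded:
  assumes "ms \<in> chains r n"
  shows "set ms \<subseteq> {..n}"
proof (cases ms rule: rev_cases)
  case (snoc xs x)
  with assms show ?thesis
    by (auto simp: chains_def sorted_wrt_append less_imp_le)
qed simp

lemma finite_chains: "finite (chains r n)"
proof (rule finite_subset)
  show "chains r n \<subseteq> {ms. set ms \<subseteq> {..n} \<and> length ms = r}"
    by (intro subsetI CollectI conjI chains_bounded) (auto simp: chains_def)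
  show "finite {ms. set ms \<subseteq> {..n} \<and> length ms = r}"
    by (rule finite_lists_length_eq) simp
qed

lemma multi_log_Nil: "multi_log [] = 1"
proof (rule fps_ext)
  fix n
  have "chains 0 n = (if n = 0 then {[]} else {})"
    by (auto simp: chains_def)
  then show "fps_nth (multi_log []) n = fps_nth 1 n"
    by (simp add: multi_log_def)
qed

text \<open>
  Both compositions in \<open>multi_Stirling\<close> are with series without constant term,
  so they are the usual substitutions, and the generating function starts at
  the length of the index.
\<close>

lemma inner_constant_terms:
  "fps_nth (1 - fps_exp (1::rat)) 0 = 0"
  "fps_nth (1 - (fps_exp 1 oo (1 - fps_exp (1::rat)))) 0 = 0"
  by simp_all

lemma multi_Stirling_gf:
  "multi_log ks oo (1 - (fps_exp 1 oo (1 - fps_exp 1))) =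
     Abs_fps (\<lambda>n. multi_Stirling n ks / fact n)"
  by (rule fps_ext) (simp add: multi_Stirling_def)

lemma chains_empty:
  assumes "n < r"
  shows "chains r n = {}"
proof (rule ccontr)
  assume "chains r n \<noteq> {}"
  then obtain ms where ms: "ms \<in> chains r n" by blast
  then have "set ms \<subseteq> {1..n}" "distinct ms" "length ms = r"
    using chains_bounded[OF ms]
    by (auto simp: chains_def Suc_le_eq strict_sorted_iff)
  then show False
    using card_mono[of "{1..n}" "set ms"] assms by (simp add: distinct_card)
qed

lemma multi_Stirling_less:
  assumes "n < length ks"
  shows "multi_Stirling n ks = 0"
  using assms by (simp add: multi_Stirling_def fps_compose_nth multi_log_def chains_empty)

text \<open>
  \<open>Stirling\<close> is defined by its recurrence; it satisfies the identity expressing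
  powers in falling factorials.
\<close>

lemma power_eq_sum_Stirling:
  fixes x :: "'a :: comm_ring_1"
  shows "x ^ n = (\<Sum>k\<le>n. of_nat (Stirling n k) * (\<Prod>i<k. x - of_nat i))"
proof (induction n)
  case (Suc n)
  define F where "F k = (\<Prod>i<k. x - of_nat i)" for k
  have step: "x * F k = F (Suc k) + of_nat k * F k" for k
    by (simp add: F_def algebra_simps)
  define G where "G k = of_nat k * of_nat (Stirling n k) * F k" for k
  have G: "(\<Sum>k\<le>n. G k) = (\<Sum>k\<le>n. G (Suc k))"
  proof -
    have "(\<Sum>k\<le>n. G k) = (\<Sum>k\<le>Suc n. G k)"
      by (simp add: G_def)
    also have "\<dots> = G 0 + (\<Sum>k\<le>n. G (Suc k))"
      by (rule sum.atMost_Suc_shift)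
    finally show ?thesis by (simp add: G_def)
  qed
  have "x ^ Suc n = (\<Sum>k\<le>n. of_nat (Stirling n k) * (x * F k))"
    using Suc by (simp add: F_def sum_distrib_left mult.left_commute)
  also have "\<dots> = (\<Sum>k\<le>n. of_nat (Stirling n k) * F (Suc k)) + (\<Sum>k\<le>n. G k)"
    by (simp add: step G_def algebra_simps sum.distrib)
  also have "\<dots> = (\<Sum>k\<le>n. of_nat (Stirling (Suc n) (Suc k)) * F (Suc k))"
    unfolding G by (simp add: G_def algebra_simps sum.distrib)
  also have "\<dots> = (\<Sum>k\<le>Suc n. of_nat (Stirling (Suc n) k) * F k)"
    by (subst sum.atMost_Suc_shift) simp
  finally show ?case by (simp add: F_def)
qed simp

end

theory Submission
  imports Defs
begin

text \<open>
  Write \<open>u = 1 - e\<^sup>\<phi>\<close> with \<open>\<phi> = 1 - e\<^sup>t\<close>, and let \<open>G\<^sub>r\<close> be the composition with \<open>u\<close> of the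
  multiple logarithm of index \<open>(1, \<dots>, 1)\<close> (\<open>r\<close> ones). Differentiating a multiple logarithm whose
  last index is 1 cancels the factor \<open>m\<^sub>r\<close> in the denominator and leaves a geometric sum over
  \<open>m\<^sub>r\<close>; hence that derivative is the logarithm with the last index removed, divided by \<open>1 - t\<close>
  (lemma \<open>one_minus_X_mult_deriv_multi_log\<close>).

  The substitution turns \<open>1 - t\<close> into \<open>1 - u = e\<^sup>\<phi>\<close>, while \<open>u' = e\<^sup>t e\<^sup>\<phi>\<close>. The factors \<open>e\<^sup>\<phi>\<close>
  cancel in the chain rule, which gives \<open>G\<^sub>r\<^sub>+\<^sub>1' = e\<^sup>t G\<^sub>r\<close>. The series \<open>(e\<^sup>t - 1)\<^sup>r / r!\<close> satisfy
  the same differential equations with the same constant terms, so by induction on \<open>r\<close> they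
  are the \<open>G\<^sub>r\<close> (lemma \<open>multi_log_ones_compose\<close>), and they are the exponential generating
  functions of the Stirling numbers (lemma \<open>Stirling_egf\<close>).
\<close>

unbundle fps_syntax

text \<open>
  Chains are split at their largest element, since it is this element that is the exponent of \<open>t\<close>
  and is affected by differentiation.
\<close>

lemma chains_Suc: "chains (Suc r) n = (\<Union>m<n. (\<lambda>ms. ms @ [n]) ` chains r m)"
proof (intro equalityI subsetI)
  fix xs assume xs: "xs \<in> chains (Suc r) n"
  then obtain ms where ms: "xs = ms @ [n]"
    by (cases xs rule: rev_cases) (auto simp: chains_def)
  have "last (0 # ms) \<in> set (0 # ms)"
    by (rule last_in_set) simp
  then have "last (0 # ms) < n"
    using xs unfolding ms by (auto simp: chains_def sorted_wrt_append)
  moreover have "ms \<in> chains r (last (0 # ms))"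
    using xs unfolding ms by (auto simp: chains_def sorted_wrt_append)
  ultimately show "xs \<in> (\<Union>m<n. (\<lambda>ms. ms @ [n]) ` chains r m)"
    using ms by blast
next
  fix xs assume "xs \<in> (\<Union>m<n. (\<lambda>ms. ms @ [n]) ` chains r m)"
  then obtain m ms where "m < n" and ms: "ms \<in> chains r m" and xs: "xs = ms @ [n]"
    by blast
  then show "xs \<in> chains (Suc r) n"
    using chains_bounded[OF ms] by (fastforce simp: chains_def sorted_wrt_append)
qed

lemma multi_log_snoc_nth:
  "multi_log (ks @ [k]) $ n = (\<Sum>m<n. multi_log ks $ m) / of_nat n powi k"
proof -
  let ?r = "length ks"
  let ?w = "\<lambda>ks ms. 1 / (\<Prod>i<length ks. of_nat (ms ! i) powi (ks ! i)) :: rat"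
  have w: "?w (ks @ [k]) (ms @ [n]) = ?w ks ms / of_nat n powi k"
    if "ms \<in> chains ?r m" for ms m
    using that by (simp add: chains_def nth_append)
  have "multi_log (ks @ [k]) $ n =
      (\<Sum>xs\<in>(\<Union>m<n. (\<lambda>ms. ms @ [n]) ` chains ?r m). ?w (ks @ [k]) xs)"
    by (simp only: multi_log_def fps_nth_Abs_fps chains_Suc length_append_singleton)
  also have "\<dots> = (\<Sum>m<n. \<Sum>xs\<in>(\<lambda>ms. ms @ [n]) ` chains ?r m. ?w (ks @ [k]) xs)"
    by (rule sum.UNION_disjoint) (simp_all add: finite_chains, auto simp: chains_def)
  also have "\<dots> = (\<Sum>m<n. \<Sum>ms\<in>chains ?r m. ?w (ks @ [k]) (ms @ [n]))"
    by (simp add: sum.reindex inj_on_def)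
  also have "\<dots> = (\<Sum>m<n. \<Sum>ms\<in>chains ?r m. ?w ks ms / of_nat n powi k)"
    by (intro sum.cong refl w)
  also have "\<dots> = (\<Sum>m<n. multi_log ks $ m) / of_nat n powi k"
    by (simp add: multi_log_def sum_divide_distrib)
  finally show ?thesis .
qed

text \<open>
  The factor \<open>n\<close> produced by differentiation cancels the denominator \<open>n\<close> of the last index, so
  the coefficients of the derivative are partial sums of those of \<open>multi_log ks\<close>, and
  multiplication by \<open>1 - t\<close> takes differences.
\<close>

lemma one_minus_X_mult_deriv_multi_log:
  "(1 - fps_X) * fps_deriv (multi_log (ks @ [1])) = multi_log ks"
proof (rule fps_ext)
  have deriv_nth: "fps_deriv (multi_log (ks @ [1])) $ n = (\<Sum>m<Suc n. multi_log ks $ m)" for n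
    by (simp add: multi_log_snoc_nth del: sum.lessThan_Suc of_nat_Suc)
  fix n
  show "((1 - fps_X) * fps_deriv (multi_log (ks @ [1]))) $ n = multi_log ks $ n"
    by (cases n) (simp_all add: left_diff_distrib deriv_nth del: fps_deriv_nth)
qed

lemma multi_log_ones_compose:
  "multi_log (replicate r 1) oo (1 - (fps_exp 1 oo (1 - fps_exp 1))) =
     fps_const (1 / fact r) * (fps_exp 1 - 1) ^ r"
proof (induction r)
  case 0
  show ?case by (simp add: multi_log_Nil)
next
  case (Suc r)
  define E :: "rat fps" where "E = fps_exp 1 oo (1 - fps_exp 1)"
  define u where "u = 1 - E"
  define L :: "nat \<Rightarrow> rat fps" where "L k = multi_log (replicate k 1)" for k
  define P :: "nat \<Rightarrow> rat fps" where "P k = fps_const (1 / fact k) * (fps_exp 1 - 1) ^ k" for k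
  have u0: "u $ 0 = 0"
    by (simp add: u_def E_def)
  have uE: "1 - u = E"
    by (simp add: u_def)
  have E': "fps_deriv E = - (E * fps_exp 1)"
    by (simp add: E_def fps_compose_deriv)
  have L: "(1 - fps_X) * fps_deriv (L (Suc r)) = L r"
    using one_minus_X_mult_deriv_multi_log[of "replicate r 1"]
    by (simp add: L_def replicate_append_same)
  have IH: "L r oo u = P r"
    using Suc.IH by (simp add: L_def u_def E_def P_def)
  have "E * (fps_deriv (L (Suc r)) oo u) = ((1 - fps_X) * fps_deriv (L (Suc r))) oo u"
    by (simp add: fps_compose_mult_distrib[OF u0] fps_compose_sub_distrib u0 uE)
  also have "\<dots> = P r"
    by (simp add: L IH)
  \<comment> \<open>The chain rule supplies \<open>u' = E e\<^sup>t\<close>, whose factor \<open>E\<close> is absorbed by the left-hand side.\<close>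
  finally have P: "E * (fps_deriv (L (Suc r)) oo u) = P r" .
  have "fps_deriv u = E * fps_exp 1"
    by (simp add: u_def E')
  then have "fps_deriv (L (Suc r) oo u) = P r * fps_exp 1"
    by (simp add: fps_compose_deriv[OF u0] P[symmetric] mult_ac)
  also have "\<dots> = fps_deriv (P (Suc r))"
  proof -
    have "fps_const (1 / fact (Suc r)) * of_nat (Suc r) = fps_const (1 / fact r :: rat)"
      by (simp add: fps_of_nat[symmetric] field_simps del: of_nat_Suc)
    then show ?thesis
      by (simp add: P_def fps_deriv_power' mult.assoc[symmetric] del: of_nat_Suc power_Suc)
  qed
  finally have "fps_deriv (L (Suc r) oo u) = fps_deriv (P (Suc r))" .
  moreover have "(L (Suc r) oo u) $ 0 = P (Suc r) $ 0"
    by (simp add: L_def P_def multi_log_def chains_empty)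
  ultimately have "L (Suc r) oo u = P (Suc r)"
    by (simp add: fps_deriv_eq_iff)
  then show ?case
    by (simp only: L_def P_def u_def E_def)
qed

text \<open>
  The derivative of \<open>(e\<^sup>t - 1)\<^sup>k\<^sup>+\<^sup>1 / (k+1)!\<close> is \<open>e\<^sup>t (e\<^sup>t - 1)\<^sup>k / k!\<close>; writing the factor \<open>e\<^sup>t\<close> as
  \<open>(e\<^sup>t - 1) + 1\<close> turns this into the recurrence that defines the Stirling numbers.
\<close>

lemma Stirling_egf:
  "fps_const (1 / fact k) * (fps_exp 1 - 1) ^ k =
     Abs_fps (\<lambda>n. of_nat (Stirling n k) / fact n :: 'a :: field_char_0)"
proof -
  define P :: "nat \<Rightarrow> 'a fps" where "P k = fps_const (1 / fact k) * (fps_exp 1 - 1) ^ k" for k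
  have P': "fps_deriv (P (Suc k)) = of_nat (Suc k) * P (Suc k) + P k" for k
  proof -
    have c: "of_nat (Suc k) * fps_const (1 / fact (Suc k)) = fps_const (1 / fact k :: 'a)"
      by (simp add: fps_of_nat[symmetric] field_simps del: of_nat_Suc)
    have "fps_deriv (P (Suc k)) =
        of_nat (Suc k) * fps_const (1 / fact (Suc k)) * (((fps_exp 1 - 1) + 1) * (fps_exp 1 - 1) ^ k)"
      by (simp add: P_def fps_deriv_power' mult_ac del: of_nat_Suc power_Suc)
    also have "\<dots> = of_nat (Suc k) * P (Suc k) +
        of_nat (Suc k) * fps_const (1 / fact (Suc k)) * (fps_exp 1 - 1) ^ k"
      by (simp only: P_def distrib_left distrib_right power_Suc mult_1_left mult_ac)
    finally show ?thesis
      by (simp only: c P_def)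
  qed
  have step: "of_nat (Suc n) * P (Suc k) $ Suc n = of_nat (Suc k) * P (Suc k) $ n + P k $ n" for n k
    using arg_cong[OF P', of "\<lambda>f. f $ n"] by (simp add: fps_of_nat[symmetric] del: of_nat_Suc)
  have "fact n * P k $ n = of_nat (Stirling n k)" for n
  proof (induction n k rule: Stirling.induct)
    case (4 n k)
    have "fact (Suc n) * P (Suc k) $ Suc n = fact n * (of_nat (Suc n) * P (Suc k) $ Suc n)"
      by (simp add: algebra_simps)
    also have "\<dots> = of_nat (Suc k) * (fact n * P (Suc k) $ n) + fact n * P k $ n"
      by (simp only: step) (simp add: algebra_simps)
    finally show ?case
      using 4 by (simp add: distrib_right)
  qed (simp_all add: P_def)
  then have "P k $ n = of_nat (Stirling n k) / fact n" for n
    by (simp add: field_simps)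
  then show ?thesis
    by (intro fps_ext) (simp add: P_def)
qed

theorem theorem1:
  fixes n r :: nat
  assumes "n \<ge> r"
  shows "multi_Stirling n (replicate r 1) = of_nat (Stirling n r)"
  by (simp add: multi_Stirling_def multi_log_ones_compose Stirling_egf)

end
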